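(* Let $\mathcal{G}=\{G_1,\dots,G_n\}$ be an instance of $k$-CMeans in $\mathbb{R}^d$, and let $\mathcal{C}=\{c_1,\dots,c_k\}$ be the set of the $k$ mean points of a $c$-approximation solution of (ordinary) $k$-means on the points $\bigcup_{i=1}^n G_i$, where $c$ is a constant. Then $[\mathcal{C}]^k=\underbrace{\mathcal{C}\times\cdots\times\mathcal{C}}_{k}$ contains at least one $k$-tuple which induces a $(2ck^2+2k-1)$-approximation of $k$-CMeans on $\mathcal{G}$.
   Context: An instance of $k$-CMeans is a set $\mathcal{G}=\{G_1,\dots,G_n\}$ of $n$ point-sets, each $G_i=\{p^i_1,\dots,p^i_{k_i}\}$ consisting of $k_i\le k$ points in $\mathbb{R}^d$. A chromatic partition of $\mathcal{G}$ is a partition of the $\sum_i k_i$ points into $k$ sets $U_1,\dots,U_k$ such that each $U_j$ contains at most one point from each $G_i$. The $k$-CMeans problem is to find $m_1,\dots,m_k\in\mathbb{R}^d$ and a chromatic partition $U_1,\dots,U_k$ minimizing $\frac1n\sum_{j}\sum_{q\in U_j}\|q-m_j\|^2$. A $c$-approximation solution of $k$-means on a finite point set $Q$ is a partition of $Q$ into $k$ clusters $S_1,\dots,S_k$ with mean points $c_1,\dots,c_k$ ($c_j=\frac{1}{|S_j|}\sum_{p\in S_j}p$) such that $\sum_{j}\sum_{p\in S_j}\|p-c_j\|^2$ is at most $c$ times the minimum of this quantity over all partitions of $Q$ into $k$ clusters. A $k$-tuple $(x_1,\dots,x_k)$ of points (repetitions allowed) induces the solution of $k$-CMeans with centers $m_j=x_j$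 and with a chromatic partition $U_1,\dots,U_k$ minimizing the objective for these fixed centers (for each $G_i$ this is a minimum-weight bipartite matching of $G_i$ to the $k$ indices, with squared distances as weights). It induces a $\rho$-approximation if the resulting objective value is at most $\rho$ times the optimal $k$-CMeans objective value. *)

theory Defs
  imports "HOL-Analysis.Analysis"
begin

text \<open>Parts are indexed by \<open>1, \<dots>, k\<close> and may be empty: a chromatic partition of an instance
  with fewer than \<open>k\<close> points has to use empty parts.\<close>

definition indexed_partition :: "nat \<Rightarrow> 'b set \<Rightarrow> (nat \<Rightarrow> 'b set) \<Rightarrow> bool" where
  "indexed_partition k Q S \<longleftrightarrow> (\<Union>j\<in>{1..k}. S j) = Q \<and> disjoint_family_on S {1..k}"

text \<open>For \<open>k\<close>-means, points are elements \<open>p\<close> of a finite set \<open>Q\<close> with locations \<open>loc p\<close>, so that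
  a location occurring several times is counted with its multiplicity. A plain point set is the
  case \<open>loc = (\<lambda>p. p)\<close>.\<close>

definition mean_point :: "('b \<Rightarrow> 'a::euclidean_space) \<Rightarrow> 'b set \<Rightarrow> 'a" where
  "mean_point loc A = (\<Sum>p\<in>A. loc p) /\<^sub>R real (card A)"

definition kmeans_cost :: "nat \<Rightarrow> ('b \<Rightarrow> 'a::euclidean_space) \<Rightarrow> (nat \<Rightarrow> 'b set) \<Rightarrow> real" where
  "kmeans_cost k loc S = (\<Sum>j=1..k. \<Sum>p\<in>S j. (norm (loc p - mean_point loc (S j)))\<^sup>2)"

definition kmeans_opt :: "nat \<Rightarrow> ('b \<Rightarrow> 'a::euclidean_space) \<Rightarrow> 'b set \<Rightarrow> real" where
  "kmeans_opt k loc Q = Inf {kmeans_cost k loc S | S. indexed_partition k Q S}"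

text \<open>An empty cluster has no mean; the point \<open>\<mu> j\<close> attached to it is left arbitrary.\<close>

definition kmeans_approx_solution ::
  "real \<Rightarrow> nat \<Rightarrow> ('b \<Rightarrow> 'a::euclidean_space) \<Rightarrow> 'b set \<Rightarrow> (nat \<Rightarrow> 'b set) \<Rightarrow> (nat \<Rightarrow> 'a) \<Rightarrow> bool"
where
  "kmeans_approx_solution c k loc Q S \<mu> \<longleftrightarrow>
     indexed_partition k Q S \<and>
     (\<forall>j\<in>{1..k}. S j \<noteq> {} \<longrightarrow> \<mu> j = mean_point loc (S j)) \<and>
     kmeans_cost k loc S \<le> c * kmeans_opt k loc Q"

definition cmeans_instance :: "nat \<Rightarrow> nat \<Rightarrow> (nat \<Rightarrow> 'a::euclidean_space set) \<Rightarrow> bool" where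
  "cmeans_instance n k G \<longleftrightarrow> (\<forall>i\<in>{1..n}. finite (G i) \<and> card (G i) \<le> k)"

text \<open>A point of an instance is a pair \<open>(i, q)\<close> with \<open>q \<in> G i\<close>. There are
  \<open>\<Sum>i=1..n. card (G i)\<close> of them, also when the sets \<open>G i\<close> overlap.\<close>

definition cmeans_points :: "nat \<Rightarrow> (nat \<Rightarrow> 'a::euclidean_space set) \<Rightarrow> (nat \<times> 'a) set" where
  "cmeans_points n G = (SIGMA i:{1..n}. G i)"

text \<open>Injectivity of \<^const>\<open>fst\<close> on \<open>U j\<close> says that \<open>U j\<close> has at most one point from each \<open>G i\<close>.\<close>

definition chromatic_partition ::
  "nat \<Rightarrow> nat \<Rightarrow> (nat \<Rightarrow> 'a::euclidean_space set) \<Rightarrow> (nat \<Rightarrow> (nat \<times> 'a) set) \<Rightarrow> bool"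
where
  "chromatic_partition n k G U \<longleftrightarrow>
     indexed_partition k (cmeans_points n G) U \<and> (\<forall>j\<in>{1..k}. inj_on fst (U j))"

definition cmeans_objective ::
  "nat \<Rightarrow> nat \<Rightarrow> (nat \<Rightarrow> 'a::euclidean_space) \<Rightarrow> (nat \<Rightarrow> (nat \<times> 'a) set) \<Rightarrow> real"
where
  "cmeans_objective n k m U = 1 / real n * (\<Sum>j=1..k. \<Sum>q\<in>U j. (norm (snd q - m j))\<^sup>2)"

definition cmeans_opt :: "nat \<Rightarrow> nat \<Rightarrow> (nat \<Rightarrow> 'a::euclidean_space set) \<Rightarrow> real" where
  "cmeans_opt n k G = Inf {cmeans_objective n k m U | m U. chromatic_partition n k G U}"

definition induces_cmeans_solution ::
  "nat \<Rightarrow> nat \<Rightarrow> (nat \<Rightarrow> 'a::euclidean_space set) \<Rightarrow> (nat \<Rightarrow> 'a) \<Rightarrow> (nat \<Rightarrow> (nat \<times> 'a) set) \<Rightarrow> bool"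
where
  "induces_cmeans_solution n k G x U \<longleftrightarrow>
     is_arg_min (cmeans_objective n k x) (chromatic_partition n k G) U"

text \<open>All minimizing partitions for \<open>x\<close> have the same objective value, so it does not matter
  which one is taken.\<close>

definition induces_cmeans_approx ::
  "nat \<Rightarrow> nat \<Rightarrow> (nat \<Rightarrow> 'a::euclidean_space set) \<Rightarrow> (nat \<Rightarrow> 'a) \<Rightarrow> real \<Rightarrow> bool"
where
  "induces_cmeans_approx n k G x \<rho> \<longleftrightarrow>
     (\<exists>U. induces_cmeans_solution n k G x U \<and> cmeans_objective n k x U \<le> \<rho> * cmeans_opt n k G)"

end

theory Submission imports Defs begin

text \<open>Let \<open>U\<close> be any chromatic partition. Replacing its centers by the means \<open>m\<^sub>j\<close> of its parts
  does not increase its cost, which is then the \<open>k\<close>-means cost \<open>W\<close> of \<open>U\<close>; hence the given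
  \<open>k\<close>-means solution \<open>S\<close> costs at most \<open>c W\<close>. By pigeonhole some cluster \<open>S\<^sub>l\<close> contains a fraction
  at least \<open>1/k\<close> of \<open>U\<^sub>j\<close>; take its mean \<open>\<mu>\<^sub>l\<close> as the center of \<open>U\<^sub>j\<close>. The points of
  \<open>U\<^sub>j \<inter> S\<^sub>l\<close> are close to both \<open>m\<^sub>j\<close> and \<open>\<mu>\<^sub>l\<close>, which bounds \<open>|U\<^sub>j| |m\<^sub>j - \<mu>\<^sub>l|\<^sup>2\<close>, the extra cost
  of this choice; the total is at most \<open>(2ck + 2k + 1) W\<close>. That is good enough if \<open>k \<ge> 2\<close> and
  \<open>c \<ge> 1\<close>. If \<open>c < 1\<close> then \<open>S\<close> has cost \<open>0\<close>, and if \<open>k = 1\<close> then \<open>m\<^sub>1 = \<mu>\<^sub>1\<close>; both cases admit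
  a better estimate.\<close>

section \<open>Sums of squared distances to a mean and to another point\<close>

text \<open>Expanding around the mean, the cross term vanishes because the deviations from the mean
  add up to zero.\<close>

lemma sum_dist_mean_point:
  fixes loc :: "'b \<Rightarrow> 'a::euclidean_space"
  assumes "finite A"
  shows "(\<Sum>p\<in>A. (norm (loc p - y))\<^sup>2) =
    (\<Sum>p\<in>A. (norm (loc p - mean_point loc A))\<^sup>2) + real (card A) * (norm (mean_point loc A - y))\<^sup>2"
proof (cases "A = {}")
  case False
  define m where "m = mean_point loc A"
  have "real (card A) *\<^sub>R m = sum loc A"
    using assms False by (simp add: m_def mean_point_def)
  then have *: "(\<Sum>p\<in>A. loc p - m) = 0"
    by (simp add: sum_subtractf sum_constant_scaleR)
  have "(norm (loc p - y))\<^sup>2 = (norm (loc p - m))\<^sup>2 + (norm (m - y))\<^sup>2 + 2 * ((loc p - m) \<bullet> (m - y))"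
    for p by (simp add: power2_norm_eq_inner inner_simps inner_commute)
  then have "(\<Sum>p\<in>A. (norm (loc p - y))\<^sup>2) = (\<Sum>p\<in>A. (norm (loc p - m))\<^sup>2)
      + real (card A) * (norm (m - y))\<^sup>2 + 2 * ((\<Sum>p\<in>A. loc p - m) \<bullet> (m - y))"
    by (simp add: sum.distrib sum_distrib_left inner_sum_left)
  then show ?thesis
    using * by (simp add: m_def)
qed simp

lemma norm_diff_power2_le:
  fixes a b p :: "'a::real_inner"
  shows "(norm (a - b))\<^sup>2 \<le> 2 * (norm (p - a))\<^sup>2 + 2 * (norm (p - b))\<^sup>2"
proof -
  have "2 * (norm (p - a))\<^sup>2 + 2 * (norm (p - b))\<^sup>2 - (norm (a - b))\<^sup>2 = (norm ((p - a) + (p - b)))\<^sup>2"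
    by (simp add: power2_norm_eq_inner inner_simps inner_commute)
  then show ?thesis
    using zero_le_power2[of "norm ((p - a) + (p - b))"] by linarith
qed

text \<open>Only \<open>card A\<close> times the squared distance from the mean to \<open>y\<close>
  has to be bounded. It is at most \<open>k\<close> times the same constant summed over
  \<open>B\<close>, and each summand is split at a point of \<open>B\<close>. The other two bounds
  serve the cases where the first is too weak.\<close>

lemma sum_dist_large_subset:
  fixes loc :: "'b \<Rightarrow> 'a::euclidean_space" and y :: 'a and k :: nat
  assumes "finite A" "B \<subseteq> A" "card A \<le> k * card B"
  defines "W \<equiv> \<Sum>p\<in>A. (norm (loc p - mean_point loc A))\<^sup>2"
    and "E \<equiv> \<Sum>p\<in>B. (norm (loc p - y))\<^sup>2"
  shows "(\<Sum>p\<in>A. (norm (loc p - y))\<^sup>2) \<le> (2 * real k + 1) * W + 2 * real k * E"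
    and "E = 0 \<Longrightarrow> (\<Sum>p\<in>A. (norm (loc p - y))\<^sup>2) \<le> (real k + 1) * W"
    and "k = 1 \<Longrightarrow> (\<Sum>p\<in>A. (norm (loc p - y))\<^sup>2) = E"
proof -
  define m where "m = mean_point loc A"
  have fB: "finite B"
    using assms finite_subset by blast
  have eq: "(\<Sum>p\<in>A. (norm (loc p - y))\<^sup>2) = W + real (card A) * (norm (m - y))\<^sup>2"
    using sum_dist_mean_point[OF assms(1)] by (simp add: W_def m_def)
  have "real (card A) \<le> real k * real (card B)"
    using assms(3) by (metis of_nat_le_iff of_nat_mult)
  then have card_A: "real (card A) * (norm (m - y))\<^sup>2 \<le> real k * (\<Sum>p\<in>B. (norm (m - y))\<^sup>2)"
    using mult_right_mono[of "real (card A)" "real k * real (card B)" "(norm (m - y))\<^sup>2"]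
    by (simp add: mult.assoc)
  have WB: "(\<Sum>p\<in>B. (norm (loc p - m))\<^sup>2) \<le> W"
    unfolding W_def m_def by (rule sum_mono2) (use assms in auto)
  have "(\<Sum>p\<in>B. (norm (m - y))\<^sup>2)
      \<le> (\<Sum>p\<in>B. 2 * (norm (loc p - m))\<^sup>2 + 2 * (norm (loc p - y))\<^sup>2)"
    by (intro sum_mono norm_diff_power2_le)
  also have "\<dots> \<le> 2 * W + 2 * E"
    using WB by (simp add: sum.distrib E_def flip: sum_distrib_left)
  finally have "real k * (\<Sum>p\<in>B. (norm (m - y))\<^sup>2) \<le> real k * (2 * W + 2 * E)"
    by (rule mult_left_mono) simp
  then show "(\<Sum>p\<in>A. (norm (loc p - y))\<^sup>2) \<le> (2 * real k + 1) * W + 2 * real k * E"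
    using eq card_A by (simp add: algebra_simps)
  show "(\<Sum>p\<in>A. (norm (loc p - y))\<^sup>2) \<le> (real k + 1) * W" if "E = 0"
  proof -
    have "loc p = y" if "p \<in> B" for p
      using \<open>E = 0\<close> that fB by (simp add: E_def sum_nonneg_eq_0_iff)
    then have "(\<Sum>p\<in>B. (norm (m - y))\<^sup>2) \<le> W"
      using WB by (simp add: norm_minus_commute)
    then have "real k * (\<Sum>p\<in>B. (norm (m - y))\<^sup>2) \<le> real k * W"
      by (rule mult_left_mono) simp
    then show ?thesis
      using eq card_A by (simp add: algebra_simps)
  qed
  \<comment> \<open>Now \<open>card A \<le> card B\<close>, which forces
    \<open>B = A\<close>.\<close>
  show "(\<Sum>p\<in>A. (norm (loc p - y))\<^sup>2) = E" if "k = 1"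
    using card_seteq[OF assms(1,2)] assms(3) that by (simp add: E_def)
qed

section \<open>Counting along a partition\<close>

lemma indexed_partition_sum:
  assumes "indexed_partition k Q S" "finite A" "A \<subseteq> Q"
  shows "sum f A = (\<Sum>j=1..k. sum f (A \<inter> S j))"
proof -
  have "A = (\<Union>j\<in>{1..k}. A \<inter> S j)"
    using assms by (auto simp: indexed_partition_def)
  then have "sum f A = sum f (\<Union>j\<in>{1..k}. A \<inter> S j)"
    by simp
  also have "\<dots> = (\<Sum>j=1..k. sum f (A \<inter> S j))"
    by (rule sum.UNION_disjoint)
      (use assms in \<open>auto simp: indexed_partition_def disjoint_family_on_def\<close>)
  finally show ?thesis .
qed

lemma indexed_partition_large_part:
  assumes "indexed_partition k Q S" "finite A" "A \<subseteq> Q" "k \<ge> 1"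
  obtains l where "l \<in> {1..k}" "card A \<le> k * card (A \<inter> S l)"
proof (rule ccontr)
  assume "\<not> thesis"
  then have small: "\<forall>l\<in>{1..k}. k * card (A \<inter> S l) < card A"
    using that by (meson not_le)
  have "k * card A = (\<Sum>l=1..k. k * card (A \<inter> S l))"
    using indexed_partition_sum[OF assms(1-3), of "\<lambda>_. 1::nat"] by (simp add: sum_distrib_left)
  also have "\<dots> < (\<Sum>l=1..k. card A)"
    by (rule sum_strict_mono) (use small \<open>k \<ge> 1\<close> in auto)
  finally show False
    by simp
qed

lemma indexed_partition_part_subset:
  "indexed_partition k Q S \<Longrightarrow> j \<in> {1..k} \<Longrightarrow> S j \<subseteq> Q"
  by (auto simp: indexed_partition_def)

section \<open>Costs of k-means and tuples of its centers\<close>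

lemma kmeans_cost_nonneg: "kmeans_cost k loc S \<ge> 0"
  by (simp add: kmeans_cost_def sum_nonneg)

lemma kmeans_opt_le:
  "indexed_partition k Q S \<Longrightarrow> kmeans_opt k loc Q \<le> kmeans_cost k loc S"
  unfolding kmeans_opt_def
  by (intro cInf_lower bdd_belowI[of _ 0]) (auto simp: kmeans_cost_nonneg)

lemma kmeans_cost_le_sum_dist:
  assumes "indexed_partition k Q U" "finite Q"
  shows "kmeans_cost k loc U \<le> (\<Sum>j=1..k. \<Sum>q\<in>U j. (norm (loc q - m j))\<^sup>2)"
  unfolding kmeans_cost_def
proof (rule sum_mono)
  fix j assume "j \<in> {1..k}"
  then have "finite (U j)"
    using assms indexed_partition_part_subset finite_subset by metis
  then show "(\<Sum>p\<in>U j. (norm (loc p - mean_point loc (U j)))\<^sup>2) \<le> (\<Sum>q\<in>U j. (norm (loc q - m j))\<^sup>2)"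
    by (simp add: sum_dist_mean_point[where y = "m j"])
qed

lemma kmeans_centers_approx:
  fixes loc :: "'b \<Rightarrow> 'a::euclidean_space"
  assumes sol: "kmeans_approx_solution c k loc Q S \<mu>" and "finite Q" "k \<ge> 1" "c > 0"
    and U: "indexed_partition k Q U"
  obtains x where "x \<in> {1..k} \<rightarrow>\<^sub>E \<mu> ` {1..k}"
    "(\<Sum>j=1..k. \<Sum>q\<in>U j. (norm (loc q - x j))\<^sup>2)
       \<le> (2 * c * (real k)\<^sup>2 + 2 * real k - 1) * kmeans_cost k loc U"
proof -
  define W where "W j = (\<Sum>p\<in>U j. (norm (loc p - mean_point loc (U j)))\<^sup>2)" for j
  \<comment> \<open>The cost of \<open>S\<close> is split along both partitions:
    \<open>E j l\<close> is the share of the points common to \<open>U j\<close> and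
    \<open>S l\<close>.\<close>
  define E where "E j l = (\<Sum>p\<in>U j \<inter> S l. (norm (loc p - \<mu> l))\<^sup>2)" for j l
  define K where "K = kmeans_cost k loc S"
  have S: "indexed_partition k Q S"
    and \<mu>: "\<And>l. l \<in> {1..k} \<Longrightarrow> S l \<noteq> {} \<Longrightarrow> \<mu> l = mean_point loc (S l)"
    and approx: "K \<le> c * kmeans_opt k loc Q"
    using sol by (auto simp: kmeans_approx_solution_def K_def)
  have fin: "finite (U j)" "U j \<subseteq> Q" "finite (S j)" "S j \<subseteq> Q" if "j \<in> {1..k}" for j
    using that S U \<open>finite Q\<close> indexed_partition_part_subset finite_subset by metis+
  have W_sum: "kmeans_cost k loc U = (\<Sum>j=1..k. W j)"
    by (simp add: kmeans_cost_def W_def)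
  have W_nonneg: "W j \<ge> 0" and E_nonneg: "E j l \<ge> 0" for j l
    by (simp_all add: W_def E_def sum_nonneg)
  have E_sum: "K = (\<Sum>j=1..k. \<Sum>l=1..k. E j l)"
  proof -
    \<comment> \<open>An arbitrary \<open>\<mu> l\<close> of an empty cluster does no harm, as its
      sum is empty.\<close>
    have "K = (\<Sum>l=1..k. \<Sum>p\<in>S l. (norm (loc p - \<mu> l))\<^sup>2)"
      unfolding K_def kmeans_cost_def by (intro sum.cong refl) (use \<mu> in fastforce)
    also have "\<dots> = (\<Sum>l=1..k. \<Sum>j=1..k. E j l)"
      by (intro sum.cong refl)
        (simp add: indexed_partition_sum[OF U] fin E_def Int_commute)
    also have "\<dots> = (\<Sum>j=1..k. \<Sum>l=1..k. E j l)"
      by (rule sum.swap)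
    finally show ?thesis .
  qed
  have "\<exists>l\<in>{1..k}. card (U j) \<le> k * card (U j \<inter> S l)" if "j \<in> {1..k}" for j
    using indexed_partition_large_part[OF S fin(1,2)[OF that] \<open>k \<ge> 1\<close>] by blast
  then obtain l where l: "\<And>j. j \<in> {1..k} \<Longrightarrow> l j \<in> {1..k}"
    and large: "\<And>j. j \<in> {1..k} \<Longrightarrow> card (U j) \<le> k * card (U j \<inter> S (l j))"
    by metis
  \<comment> \<open>Several \<open>j\<close> may share one \<open>l j\<close>, so the tuple may
    repeat centers.\<close>
  define x where "x = restrict (\<lambda>j. \<mu> (l j)) {1..k}"
  define V where "V j = (\<Sum>q\<in>U j. (norm (loc q - x j))\<^sup>2)" for j
  have V: "V j = (\<Sum>q\<in>U j. (norm (loc q - \<mu> (l j)))\<^sup>2)" if "j \<in> {1..k}" for j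
    using that by (simp add: V_def x_def)
  have E_le: "E j (l j) \<le> (\<Sum>l=1..k. E j l)" if "j \<in> {1..k}" for j
    using l[OF that] by (intro member_le_sum) (auto simp: E_nonneg)
  have K_le: "K \<le> c * (\<Sum>j=1..k. W j)"
    using approx mult_left_mono[OF kmeans_opt_le[OF U, of loc] less_imp_le[OF \<open>c > 0\<close>]]
    unfolding W_sum by linarith
  \<comment> \<open>\<open>S\<close> itself competes for the optimum, so its cost is at most
    \<open>c\<close> times itself.\<close>
  have K_zero: "K = 0 \<or> c \<ge> 1"
  proof -
    have "K \<le> c * K"
      using approx mult_left_mono[OF kmeans_opt_le[OF S, of loc] less_imp_le[OF \<open>c > 0\<close>]]
      unfolding K_def by linarith
    moreover have "K \<ge> 0"
      by (simp add: K_def kmeans_cost_nonneg)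
    ultimately show ?thesis
      using mult_le_cancel_right1[of K c] by auto
  qed
  have bounds: "V j \<le> (2 * real k + 1) * W j + 2 * real k * E j (l j)"
      "E j (l j) = 0 \<Longrightarrow> V j \<le> (real k + 1) * W j"
      "k = 1 \<Longrightarrow> V j = E j (l j)" if j: "j \<in> {1..k}" for j
    unfolding V[OF j] W_def E_def
    by (rule sum_dist_large_subset[OF fin(1)[OF j] Int_lower1 large[OF j]]; assumption)+
  \<comment> \<open>All cases are put into one form. Summed over \<open>j\<close>, the
    \<open>E\<close> terms give at most \<open>K\<close>, hence at most \<open>c\<close> times the
    cost of \<open>U\<close>; this yields the factor \<open>\<alpha> + \<beta> * c\<close>.\<close>
  have "\<exists>\<alpha> \<beta>. 0 \<le> \<beta> \<and> \<alpha> + \<beta> * c \<le> 2 * c * (real k)\<^sup>2 + 2 * real k - 1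
      \<and> (\<forall>j\<in>{1..k}. V j \<le> \<alpha> * W j + \<beta> * E j (l j))"
  proof (cases "k = 1")
    case True
    then have "\<forall>j\<in>{1..k}. V j \<le> 0 * W j + 1 * E j (l j)"
      using bounds(3) by auto
    then show ?thesis
      using True \<open>c > 0\<close> by (intro exI[of _ 0] exI[of _ 1]) auto
  next
    case False
    with \<open>k \<ge> 1\<close> have "k \<ge> 2"
      by simp
    then have k2: "real k \<ge> 2"
      by linarith
    show ?thesis
      using K_zero
    proof
      assume "K = 0"
      have "E j (l j) = 0" if "j \<in> {1..k}" for j
      proof -
        have "(\<Sum>l=1..k. E j l) \<le> K"
          unfolding E_sum using that by (intro member_le_sum) (auto intro: sum_nonneg E_nonneg)
        then show ?thesis
          using E_le[OF that] E_nonneg[of j "l j"] \<open>K = 0\<close> by linarith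
      qed
      then have "\<forall>j\<in>{1..k}. V j \<le> (real k + 1) * W j + 0 * E j (l j)"
        using bounds(2) by auto
      moreover have "(real k + 1) + 0 * c \<le> 2 * c * (real k)\<^sup>2 + 2 * real k - 1"
      proof -
        have "2 * c * (real k)\<^sup>2 \<ge> 0"
          using \<open>c > 0\<close> by simp
        then show ?thesis
          using k2 by linarith
      qed
      ultimately show ?thesis
        by (intro exI[of _ "real k + 1"] exI[of _ 0]) auto
    next
      assume "c \<ge> 1"
      have "\<forall>j\<in>{1..k}. V j \<le> (2 * real k + 1) * W j + 2 * real k * E j (l j)"
        using bounds(1) by blast
      moreover have "(2 * real k + 1) + 2 * real k * c \<le> 2 * c * (real k)\<^sup>2 + 2 * real k - 1"
      proof -
        \<comment> \<open>After cancellation the claim reads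
          \<open>1 \<le> c * (real k * (real k - 1))\<close>.\<close>
        have "1 * (2 * 1) \<le> c * (real k * (real k - 1))"
          using k2 \<open>c \<ge> 1\<close> by (intro mult_mono) auto
        then show ?thesis
          by (simp add: power2_eq_square algebra_simps)
      qed
      ultimately show ?thesis
        by (intro exI[of _ "2 * real k + 1"] exI[of _ "2 * real k"]) auto
    qed
  qed
  then obtain \<alpha> \<beta> where "\<beta> \<ge> 0"
    and \<alpha>\<beta>: "\<alpha> + \<beta> * c \<le> 2 * c * (real k)\<^sup>2 + 2 * real k - 1"
    and V_le: "\<And>j. j \<in> {1..k} \<Longrightarrow> V j \<le> \<alpha> * W j + \<beta> * E j (l j)"
    by blast
  have "(\<Sum>j=1..k. V j) \<le> (\<Sum>j=1..k. \<alpha> * W j + \<beta> * (\<Sum>l=1..k. E j l))"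
    using V_le E_le \<open>\<beta> \<ge> 0\<close> by (intro sum_mono) (smt (verit) mult_left_mono)
  also have "\<dots> = \<alpha> * (\<Sum>j=1..k. W j) + \<beta> * K"
    by (simp add: sum.distrib sum_distrib_left E_sum)
  also have "\<dots> \<le> \<alpha> * (\<Sum>j=1..k. W j) + \<beta> * (c * (\<Sum>j=1..k. W j))"
    using K_le \<open>\<beta> \<ge> 0\<close> by (intro add_left_mono mult_left_mono)
  also have "\<dots> = (\<alpha> + \<beta> * c) * (\<Sum>j=1..k. W j)"
    by (simp add: algebra_simps)
  also have "\<dots> \<le> (2 * c * (real k)\<^sup>2 + 2 * real k - 1) * (\<Sum>j=1..k. W j)"
    using \<alpha>\<beta> by (intro mult_right_mono sum_nonneg W_nonneg)
  finally show thesis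
    using l by (intro that[of x]) (auto simp: V_def W_sum x_def)
qed

section \<open>Existence of chromatic partitions and of induced solutions\<close>

lemma finite_cmeans_points: "cmeans_instance n k G \<Longrightarrow> finite (cmeans_points n G)"
  by (auto simp: cmeans_instance_def cmeans_points_def)

text \<open>Each \<open>G i\<close> embeds into the \<open>k\<close> indices; the fibres of these
  embeddings form the parts.\<close>

lemma chromatic_partition_exists:
  assumes "cmeans_instance n k G"
  obtains U where "chromatic_partition n k G U"
proof -
  have "\<exists>f. f ` G i \<subseteq> {1..k} \<and> inj_on f (G i)" if "i \<in> {1..n}" for i
    using that assms by (intro card_le_inj) (auto simp: cmeans_instance_def)
  then obtain f where f: "\<And>i. i \<in> {1..n} \<Longrightarrow> f i ` G i \<subseteq> {1..k} \<and> inj_on (f i) (G i)"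
    by metis
  define U where "U j = {(i, q) \<in> cmeans_points n G. f i q = j}" for j
  have "(\<Union>j\<in>{1..k}. U j) = cmeans_points n G"
    using f by (fastforce simp: U_def cmeans_points_def)
  moreover have "disjoint_family_on U {1..k}"
    by (auto simp: disjoint_family_on_def U_def)
  moreover have "inj_on fst (U j)" for j
    using f by (auto simp: inj_on_def U_def cmeans_points_def)
  ultimately show thesis
    by (intro that[of U]) (simp add: chromatic_partition_def indexed_partition_def)
qed

text \<open>There are infinitely many functions \<open>U\<close>, but the objective sees only their
  values on \<open>{1..k}\<close>, which are subsets of a finite set. So it takes finitely many
  values and attains its minimum.\<close>

lemma induces_cmeans_solution_exists:
  assumes "cmeans_instance n k G"
  obtains U where "induces_cmeans_solution n k G x U"
proof -
  define P where "P = {U. chromatic_partition n k G U}"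
  have "cmeans_objective n k x ` P
      \<subseteq> cmeans_objective n k x ` ({1..k} \<rightarrow>\<^sub>E Pow (cmeans_points n G))"
  proof
    fix v assume "v \<in> cmeans_objective n k x ` P"
    then obtain U where U: "chromatic_partition n k G U" "v = cmeans_objective n k x U"
      by (auto simp: P_def)
    have "v = cmeans_objective n k x (restrict U {1..k})"
      by (simp add: U(2) cmeans_objective_def)
    moreover have "restrict U {1..k} \<in> {1..k} \<rightarrow>\<^sub>E Pow (cmeans_points n G)"
      using U(1) by (auto simp: chromatic_partition_def dest: indexed_partition_part_subset)
    ultimately show "v \<in> cmeans_objective n k x ` ({1..k} \<rightarrow>\<^sub>E Pow (cmeans_points n G))"
      by blast
  qed
  moreover have "finite ({1..k} \<rightarrow>\<^sub>E Pow (cmeans_points n G))"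
    using finite_cmeans_points[OF assms] by (intro finite_PiE) auto
  ultimately have fin: "finite (cmeans_objective n k x ` P)"
    using finite_surj by blast
  have "P \<noteq> {}"
    using chromatic_partition_exists[OF assms] by (auto simp: P_def)
  then have "Min (cmeans_objective n k x ` P) \<in> cmeans_objective n k x ` P"
    using fin by (intro Min_in) auto
  then obtain U where "U \<in> P" "cmeans_objective n k x U = Min (cmeans_objective n k x ` P)"
    by force
  then show thesis
    using fin by (intro that[of U])
      (auto simp: induces_cmeans_solution_def is_arg_min_linorder P_def)
qed

theorem theorem4:
  fixes G :: "nat \<Rightarrow> (real ^ 'd) set"
    and n k :: nat
    and c :: real
    and S :: "nat \<Rightarrow> (nat \<times> (real ^ 'd)) set"
    and \<mu> :: "nat \<Rightarrow> real ^ 'd"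
    and C :: "(real ^ 'd) set"
  assumes "cmeans_instance n k G"
    and "c > 0"
    and "kmeans_approx_solution c k snd (cmeans_points n G) S \<mu>"
    and "C = \<mu> ` {1..k}"
  shows "\<exists>x \<in> {1..k} \<rightarrow>\<^sub>E C.
           induces_cmeans_approx n k G x (2 * c * (real k)\<^sup>2 + 2 * real k - 1)"
proof -
  define \<rho> where "\<rho> = 2 * c * (real k)\<^sup>2 + 2 * real k - 1"
  have "\<exists>U. induces_cmeans_solution n k G x U" for x
    using induces_cmeans_solution_exists[OF assms(1)] by blast
  then obtain sol where sol: "\<And>x. induces_cmeans_solution n k G x (sol x)"
    by metis
  define F where "F x = cmeans_objective n k x (sol x)" for x
  have F_le: "F x \<le> cmeans_objective n k x U" if "chromatic_partition n k G U" for x U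
    using sol[of x] that by (auto simp: F_def induces_cmeans_solution_def is_arg_min_linorder)
  obtain U0 where U0: "chromatic_partition n k G U0"
    using chromatic_partition_exists[OF assms(1)] .
  define V where "V = {cmeans_objective n k m U | m U. chromatic_partition n k G U}"
  have "V \<noteq> {}"
    using U0 by (auto simp: V_def)
  have opt: "cmeans_opt n k G = Inf V"
    by (simp add: cmeans_opt_def V_def)
  show ?thesis
  proof (cases "k = 0")
    case True
    \<comment> \<open>Here \<open>\<rho>\<close> is \<open>-1\<close>, but every objective value is
      \<open>0\<close>, so the empty tuple meets the bound.\<close>
    then have "V = {0}" and "F x = 0" for x
      using U0 by (auto simp: V_def F_def cmeans_objective_def)
    then have "induces_cmeans_approx n k G (\<lambda>_. undefined) \<rho>"
      unfolding induces_cmeans_approx_def opt using sol by (force simp: F_def)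
    then show ?thesis
      using True by (simp add: \<rho>_def)
  next
    case False
    then have "k \<ge> 1" and "C \<noteq> {}" and "finite C"
      using assms(4) by auto
    have "real k \<ge> 1" "2 * c * (real k)\<^sup>2 \<ge> 0"
      using \<open>k \<ge> 1\<close> \<open>c > 0\<close> by auto
    then have "\<rho> > 0"
      unfolding \<rho>_def by linarith
    define X where "X = {1..k} \<rightarrow>\<^sub>E C"
    have "finite X" "X \<noteq> {}"
      using \<open>finite C\<close> \<open>C \<noteq> {}\<close> by (auto simp: X_def PiE_eq_empty_iff intro: finite_PiE)
    \<comment> \<open>One tuple has to be good for all \<open>(m, U)\<close> at once, so that the infimum over the infinitely
      many \<open>m\<close> need not be shown to be attained; \<open>X\<close> being finite, a best tuple will do.\<close>
    then obtain x where x: "x \<in> X" and x_min: "\<And>y. y \<in> X \<Longrightarrow> F x \<le> F y"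
      using ex_is_arg_min_if_finite[of X F] by (auto simp: is_arg_min_linorder)
    have "F x \<le> \<rho> * cmeans_objective n k m U" if U: "chromatic_partition n k G U" for m U
    proof -
      have part: "indexed_partition k (cmeans_points n G) U"
        using U by (simp add: chromatic_partition_def)
      note fin = finite_cmeans_points[OF assms(1)]
      obtain y where y: "y \<in> X" and
        y_le: "(\<Sum>j=1..k. \<Sum>q\<in>U j. (norm (snd q - y j))\<^sup>2) \<le> \<rho> * kmeans_cost k snd U"
        using kmeans_centers_approx[OF assms(3) fin \<open>k \<ge> 1\<close> \<open>c > 0\<close> part]
        unfolding X_def \<rho>_def assms(4) .
      note y_le
      also have "\<rho> * kmeans_cost k snd U \<le> \<rho> * (\<Sum>j=1..k. \<Sum>q\<in>U j. (norm (snd q - m j))\<^sup>2)"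
        using kmeans_cost_le_sum_dist[OF part fin] \<open>\<rho> > 0\<close> by (intro mult_left_mono) auto
      finally have "cmeans_objective n k y U \<le> \<rho> * cmeans_objective n k m U"
        unfolding cmeans_objective_def by (simp add: divide_right_mono)
      then show ?thesis
        using x_min[OF y] F_le[OF U, of y] by linarith
    qed
    \<comment> \<open>Dividing by \<open>\<rho>\<close> makes the estimate a lower bound of
      \<open>V\<close>, so it passes to the infimum.\<close>
    then have "F x / \<rho> \<le> v" if "v \<in> V" for v
      using that \<open>\<rho> > 0\<close> by (auto simp: V_def pos_divide_le_eq mult.commute)
    then have "F x / \<rho> \<le> Inf V"
      using \<open>V \<noteq> {}\<close> by (rule cInf_greatest[rotated])
    then have "F x \<le> \<rho> * cmeans_opt n k G"
      using \<open>\<rho> > 0\<close> by (simp add: opt pos_divide_le_eq mult.commute)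
    then show ?thesis
      using x sol[of x] unfolding X_def \<rho>_def F_def induces_cmeans_approx_def by blast
  qed
qed

end
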